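(* Let $N$ be a positive integer, let $B$ be the $N\times N$ real upper bidiagonal matrix with diagonal entries $\sqrt{q_1},\dots,\sqrt{q_N}$ and upper subdiagonal entries $\sqrt{e_1},\dots,\sqrt{e_{N-1}}$, where all $q_i>0$ and $e_i>0$. Let $g_i^{(M)}$ and $\tilde h_i^{(M)}$ ($i=1,\dots,N$, $M=1,2,\dots$) be the quantities attached to $B$ that are defined recursively in the context. Then for all $i=1,\dots,N$ and $M=2,3,\dots$, $$\tilde h_i^{(M)}=M!\cdot g_i^{(M)}.$$
   Context: The matrix $B$ has $(i,i)$-entry $\sqrt{q_i}$ ($i=1,\dots,N$), $(i,i+1)$-entry $\sqrt{e_i}$ ($i=1,\dots,N-1$), and all other entries zero. Convention: $\sum_{i=j}^{k}=0$ if $j>k$. ${}_pC_k$ denotes the binomial coefficient $\binom{p}{k}$. Put $\check B_i=1/q_i$ for $i=1,\dots,N$ and $F_i=e_i/q_i$ for $i=1,\dots,N-1$. Let $v_i^{(1)}$ denote the $(i,i)$-entry of $(B^{\top}B)^{-1}$. The quantities $g_i^{(r)}$ for $i=1,\dots,N$ and $r=1,2,\dots$ are defined by: - $g_N^{(r)}=0$ for every positive integer $r$; - $g_i^{(1)}=F_i\,v_{i+1}^{(1)}$ for $i=1,\dots,N-1$; - $g_i^{(r)}=F_i\,g_{i+1}^{(r)}+\check B_{i+1}\,g_i^{(r-1)}+\sum_{k=1}^{r-1}g_{i+1}^{(k)}\,g_i^{(r-k)}$ for $i=1,\dots,N-1$ and $r=2,3,\dots$. The quantities $\tilde h_i^{(p)}$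 for $i=1,\dots,N$ and $p=1,2,\dots$ are defined by: - $\tilde h_N^{(1)}=1/q_N$; - $\tilde h_i^{(1)}=F_i\,\tilde h_{i+1}^{(1)}+1/q_i$ for $i=1,\dots,N-1$; - $\tilde h_N^{(p)}=0$ for $p=2,3,\dots$; - $\tilde h_i^{(p)}=F_i\left(\tilde h_{i+1}^{(p)}+p\,\tilde h_{i+1}^{(1)}\tilde h_{i+1}^{(p-1)}\right)+\sum_{k=1}^{p-2}{}_pC_k\,\tilde h_{i+1}^{(k)}\tilde h_i^{(p-k)}$ for $i=1,\dots,N-1$ and $p=2,3,\dots$. *)

theory Defs
  imports Complex_Main "Jordan_Normal_Form.Gauss_Jordan_Elimination"
begin

text \<open>
  Matrix dimension \<open>N\<close>, sequences \<open>q\<close> and \<open>e\<close>, and all subscripts are 1-based: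
  \<open>q 1, \<dots>, q N\<close> and \<open>e 1, \<dots>, e (N - 1)\<close> are the relevant values.  Matrix
  entries of type \<^typ>\<open>real mat\<close> are 0-based, whence the shifts by one below.
\<close>

definition bidiag :: "nat \<Rightarrow> (nat \<Rightarrow> real) \<Rightarrow> (nat \<Rightarrow> real) \<Rightarrow> real mat" where
  "bidiag N q e = mat N N (\<lambda>(i, j).
     if j = i then sqrt (q (i + 1))
     else if j = i + 1 then sqrt (e (i + 1))
     else 0)"

definition Bcheck :: "(nat \<Rightarrow> real) \<Rightarrow> nat \<Rightarrow> real" where
  "Bcheck q i = 1 / q i"

definition Fcoef :: "(nat \<Rightarrow> real) \<Rightarrow> (nat \<Rightarrow> real) \<Rightarrow> nat \<Rightarrow> real" where
  "Fcoef q e i = e i / q i"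

text \<open>
  The inverse exists whenever \<open>q 1, \<dots>, q N\<close> are positive, so that \<open>mat_inverse\<close>
  then returns \<open>Some\<close> of it.
\<close>

definition v1 :: "nat \<Rightarrow> (nat \<Rightarrow> real) \<Rightarrow> (nat \<Rightarrow> real) \<Rightarrow> nat \<Rightarrow> real" where
  "v1 N q e i =
     the (mat_inverse ((bidiag N q e)\<^sup>T * bidiag N q e)) $$ (i - 1, i - 1)"

text \<open>
  In the two recursions below, the first line only makes the functions total; the
  meaningful arguments are \<open>1 \<le> i \<le> N\<close> and superscripts \<open>\<ge> 1\<close>.
\<close>

function g :: "nat \<Rightarrow> (nat \<Rightarrow> real) \<Rightarrow> (nat \<Rightarrow> real) \<Rightarrow> nat \<Rightarrow> nat \<Rightarrow> real" where
  "g N q e i r =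
     (if i = 0 \<or> i > N \<or> r = 0 then 0
      else if i = N then 0
      else if r = 1 then Fcoef q e i * v1 N q e (i + 1)
      else Fcoef q e i * g N q e (i + 1) r
           + Bcheck q (i + 1) * g N q e i (r - 1)
           + (\<Sum>k = 1..r - 1. g N q e (i + 1) k * g N q e i (r - k)))"
  by auto
termination
  by (relation "measures [\<lambda>(N, q, e, i, r). N - i, \<lambda>(N, q, e, i, r). r]") auto

function htilde :: "nat \<Rightarrow> (nat \<Rightarrow> real) \<Rightarrow> (nat \<Rightarrow> real) \<Rightarrow> nat \<Rightarrow> nat \<Rightarrow> real" where
  "htilde N q e i p =
     (if i = 0 \<or> i > N \<or> p = 0 then 0
      else if i = N then (if p = 1 then 1 / q N else 0)
      else if p = 1 then Fcoef q e i * htilde N q e (i + 1) 1 + 1 / q i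
      else Fcoef q e i * (htilde N q e (i + 1) p
             + real p * htilde N q e (i + 1) 1 * htilde N q e (i + 1) (p - 1))
           + (\<Sum>k = 1..p - 2.
                real (p choose k) * htilde N q e (i + 1) k * htilde N q e i (p - k)))"
  by auto
termination
  by (relation "measures [\<lambda>(N, q, e, i, p). N - i, \<lambda>(N, q, e, i, p). p]") auto

text \<open>Unconditional unfolding of these equations makes the simplifier loop.\<close>

declare g.simps [simp del] htilde.simps [simp del]

end

theory Submission
  imports Defs "Jordan_Normal_Form.Determinant"
begin

text \<open>
  Write \<open>h i p\<close> for \<open>htilde N q e i p\<close>, and similarly for the other quantities.  Both \<open>v1\<close> and
  \<open>h _ 1\<close> satisfy \<open>x i = F i * x (i + 1) + 1 / q i\<close>, so they coincide, and
  \<open>g i 1 = h i 1 - 1 / q i\<close>.  Hence \<open>1 / q (i + 1) + g (i + 1) 1 = h (i + 1) 1\<close>: the linear term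
  of the recursion for \<open>g\<close> merges with the first summand of its convolution, while the last
  summand contains \<open>g i 1 = F i * h (i + 1) 1\<close>.  What results is the recursion for \<open>h i p\<close>
  divided by \<open>p!\<close>.
\<close>

section \<open>Entries of products with the bidiagonal matrix, and its determinant\<close>

lemma bidiag_carrier [simp]: "bidiag N q e \<in> carrier_mat N N"
  by (simp add: bidiag_def)

lemma bidiag_mult_index:
  assumes "Y \<in> carrier_mat N n" "i < N" "j < n"
  shows "(bidiag N q e * Y) $$ (i, j) =
    sqrt (q (i + 1)) * Y $$ (i, j) + (if i + 1 < N then sqrt (e (i + 1)) * Y $$ (i + 1, j) else 0)"
proof -
  have "(bidiag N q e * Y) $$ (i, j) = (\<Sum>k\<in>{0..<N}. bidiag N q e $$ (i, k) * Y $$ (k, j))"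
    using assms by (auto simp: scalar_prod_def bidiag_def)
  also have "\<dots> = (\<Sum>k\<in>{0..<N}. (if k = i then sqrt (q (i + 1)) * Y $$ (i, j) else 0) +
      (if k = i + 1 then sqrt (e (i + 1)) * Y $$ (i + 1, j) else 0))"
    using assms by (intro sum.cong) (auto simp: bidiag_def)
  finally show ?thesis
    using assms by (simp add: sum.distrib)
qed

lemma transpose_bidiag_mult_index:
  assumes "Y \<in> carrier_mat N n" "i < N" "j < n"
  shows "((bidiag N q e)\<^sup>T * Y) $$ (i, j) =
    sqrt (q (i + 1)) * Y $$ (i, j) + (if 0 < i then sqrt (e i) * Y $$ (i - 1, j) else 0)"
proof -
  have "((bidiag N q e)\<^sup>T * Y) $$ (i, j) = (\<Sum>k\<in>{0..<N}. bidiag N q e $$ (k, i) * Y $$ (k, j))"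
    using assms by (auto simp: scalar_prod_def bidiag_def)
  \<comment> \<open>For \<open>i = 0\<close> the truncated \<open>i - 1\<close> is again
    \<open>0\<close>, so the inner test \<open>0 < i\<close> is what removes the spurious term at
    \<open>k = 0\<close>.\<close>
  also have "\<dots> = (\<Sum>k\<in>{0..<N}. (if k = i then sqrt (q (i + 1)) * Y $$ (i, j) else 0) +
      (if k = i - 1 then if 0 < i then sqrt (e i) * Y $$ (i - 1, j) else 0 else 0))"
    using assms by (intro sum.cong) (auto simp: bidiag_def)
  finally show ?thesis
    using assms by (simp add: sum.distrib)
qed

lemma det_bidiag: "det (bidiag N q e) = (\<Prod>i<N. sqrt (q (i + 1)))"
proof -
  have "upper_triangular (bidiag N q e)"
    by (auto simp: bidiag_def)
  then have "det (bidiag N q e) = prod_list (diag_mat (bidiag N q e))"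
    by (rule det_upper_triangular) (rule bidiag_carrier)
  also have "\<dots> = (\<Prod>i<N. sqrt (q (i + 1)))"
    unfolding prod_list_diag_prod by (simp add: bidiag_def atLeast0LessThan)
  finally show ?thesis .
qed

text \<open>The \<open>if\<close> absorbs the end index \<open>N\<close>, so that the equation has
  exactly the shape of \<open>v1_recurrence\<close> below.\<close>

lemma htilde_1:
  assumes "1 \<le> i" "i \<le> N"
  shows "htilde N q e i 1 = (if i < N then Fcoef q e i * htilde N q e (i + 1) 1 else 0) + 1 / q i"
  using assms by (subst htilde.simps) simp

lemma g_at_N: "g N q e N r = 0"
  by (subst g.simps) simp

section \<open>Diagonal of the inverse Gram matrix\<close>

locale positive_bidiagonal =
  fixes N :: nat and q e :: "nat \<Rightarrow> real"
  assumes q: "\<And>i. 1 \<le> i \<Longrightarrow> i \<le> N \<Longrightarrow> q i > 0"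
    and e: "\<And>i. 1 \<le> i \<Longrightarrow> i \<le> N - 1 \<Longrightarrow> e i > 0"
begin

text \<open>The Gram matrix is symmetric with determinant \<open>det B * det B\<close>, nonzero
  because all \<open>q i\<close> are positive. The bracketing of the last fact singles out
  \<open>B * X\<close>, the inverse of the transpose.\<close>

lemma mat_inverse_gram_bidiag:
  obtains X where "mat_inverse ((bidiag N q e)\<^sup>T * bidiag N q e) = Some X"
    and "X \<in> carrier_mat N N" "X\<^sup>T = X"
    and "(bidiag N q e)\<^sup>T * (bidiag N q e * X) = 1\<^sub>m N"
proof -
  define B where "B = bidiag N q e"
  have B: "B \<in> carrier_mat N N" by (simp add: B_def)
  have A: "B\<^sup>T * B \<in> carrier_mat N N" using B by simp
  have "det (B\<^sup>T * B) = det B * det B"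
    using B by (simp add: det_mult[of _ N] det_transpose[of _ N])
  moreover have "det B \<noteq> 0"
    unfolding B_def det_bidiag by (intro less_imp_neq[THEN not_sym] prod_pos) (simp add: q)
  ultimately have "B\<^sup>T * B \<in> Units (ring_mat TYPE(real) N ())"
    by (intro det_non_zero_imp_unit[OF A]) simp
  then obtain X where X: "mat_inverse (B\<^sup>T * B) = Some X"
    using mat_inverse(1)[OF A] by fastforce
  have inv: "B\<^sup>T * B * X = 1\<^sub>m N" "X * (B\<^sup>T * B) = 1\<^sub>m N" "X \<in> carrier_mat N N"
    using mat_inverse(2)[OF A X] by auto
  have sym: "(B\<^sup>T * B)\<^sup>T = B\<^sup>T * B"
    using B by (simp add: transpose_mult[of _ N N _ N])
  \<comment> \<open>The transpose of \<open>X\<close> is a right inverse as well; bracketing the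
    product of \<open>X\<close>, the Gram matrix and this transpose in two ways identifies it with
    \<open>X\<close>.\<close>
  have "B\<^sup>T * B * X\<^sup>T = (X * (B\<^sup>T * B))\<^sup>T"
    by (simp only: transpose_mult[OF inv(3) A] sym)
  also have "\<dots> = 1\<^sub>m N"
    using inv by simp
  finally have "X * (B\<^sup>T * B * X\<^sup>T) = X"
    using inv by (metis right_mult_one_mat)
  moreover have "X * (B\<^sup>T * B * X\<^sup>T) = X\<^sup>T"
    using inv A by (metis assoc_mult_mat left_mult_one_mat transpose_carrier_mat)
  ultimately have "X\<^sup>T = X" by simp
  moreover have "B\<^sup>T * (B * X) = 1\<^sub>m N"
    using inv B by (metis assoc_mult_mat transpose_carrier_mat)
  ultimately show thesis
    using that X inv unfolding B_def by blast
qed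

text \<open>Two entries of \<open>B * X = Y\<close> suffice: the diagonal one, where
  \<open>Y\<close> is the reciprocal of \<open>sqrt (q i)\<close>, and the one just right of it,
  where \<open>Y\<close> vanishes. Symmetry of \<open>X\<close> lets the second eliminate the
  off-diagonal entry from the first.\<close>

lemma v1_recurrence:
  assumes i: "1 \<le> i" "i \<le> N"
  shows "v1 N q e i = (if i < N then Fcoef q e i * v1 N q e (i + 1) else 0) + 1 / q i"
proof -
  obtain X where X: "mat_inverse ((bidiag N q e)\<^sup>T * bidiag N q e) = Some X"
      "X \<in> carrier_mat N N" "X\<^sup>T = X"
    and inv: "(bidiag N q e)\<^sup>T * (bidiag N q e * X) = 1\<^sub>m N"
    using mat_inverse_gram_bidiag by metis
  have v1: "v1 N q e k = X $$ (k - 1, k - 1)" for k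
    by (simp add: v1_def X)
  \<comment> \<open>\<open>Y\<close> is the inverse of the transpose of \<open>B\<close>, hence lower triangular.\<close>
  define Y where "Y = bidiag N q e * X"
  have Y: "Y \<in> carrier_mat N N"
    using X by (simp add: Y_def mult_carrier_mat[of _ N N])
  have rowB: "Y $$ (k, j) = sqrt (q (k + 1)) * X $$ (k, j) +
      (if k + 1 < N then sqrt (e (k + 1)) * X $$ (k + 1, j) else 0)" if "k < N" "j < N" for k j
    unfolding Y_def using X that by (intro bidiag_mult_index) auto
  have rowBT: "sqrt (q (k + 1)) * Y $$ (k, j) + (if 0 < k then sqrt (e k) * Y $$ (k - 1, j) else 0)
      = (if k = j then 1 else 0)" if "k < N" "j < N" for k j
    using transpose_bidiag_mult_index[OF Y that, of q e] inv that by (simp add: Y_def)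
  \<comment> \<open>Forward substitution: above the diagonal the right-hand side is zero, and so is
    the entry in the preceding row.\<close>
  have upper: "Y $$ (k, j) = 0" if "k < j" "j < N" for k j
    using that
  proof (induction k)
    case 0
    then show ?case using rowBT[of 0 j] q[of 1] by simp
  next
    case (Suc k)
    then show ?case using rowBT[of "Suc k" j] q[of "Suc (Suc k)"] by simp
  qed
  obtain k where k: "i = Suc k" "k < N" using i by (cases i) auto
  have qk: "q (Suc k) > 0" using q k by simp
  then have sq: "sqrt (q (Suc k)) * (sqrt (q (Suc k)) * x) = q (Suc k) * x" for x
    by (simp flip: mult.assoc)
  have "sqrt (q (Suc k)) * Y $$ (k, k) = 1"
    using rowBT[of k k] upper[of "k - 1" k] k by (auto split: if_splits)
  then have "sqrt (q (Suc k)) * (sqrt (q (Suc k)) * X $$ (k, k) +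
      (if Suc k < N then sqrt (e (Suc k)) * X $$ (Suc k, k) else 0)) = 1"
    using rowB[of k k] k by (simp cong: if_cong)
  then have diag: "q (Suc k) * X $$ (k, k) +
      (if Suc k < N then sqrt (e (Suc k)) * (sqrt (q (Suc k)) * X $$ (Suc k, k)) else 0) = 1"
    by (simp add: distrib_left sq mult.left_commute split: if_splits)
  show ?thesis
  proof (cases "Suc k < N")
    case True
    have "e (Suc k) > 0" using e True by simp
    then have se: "sqrt (e (Suc k)) * (sqrt (e (Suc k)) * x) = e (Suc k) * x" for x
      by (simp flip: mult.assoc)
    have "X $$ (k, Suc k) = X\<^sup>T $$ (Suc k, k)"
      using X(2) True by simp
    then have "sqrt (q (Suc k)) * X $$ (Suc k, k) = - (sqrt (e (Suc k)) * X $$ (Suc k, Suc k))"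
      using rowB[of k "Suc k"] upper[of k "Suc k"] True X(3) by simp
    then have "q (Suc k) * X $$ (k, k) - e (Suc k) * X $$ (Suc k, Suc k) = 1"
      using diag True by (simp add: se)
    then show ?thesis
      using True k qk by (simp add: v1 Fcoef_def field_simps)
  next
    case False
    then show ?thesis
      using diag k qk by (simp add: v1 field_simps)
  qed
qed

lemma htilde_1_eq_v1:
  assumes i: "1 \<le> i" "i \<le> N"
  shows "htilde N q e i 1 = v1 N q e i"
  using i(2,1)
proof (induction i rule: inc_induct)
  case base
  then show ?case
    using v1_recurrence[of N] htilde_1[of N N q e] by simp
next
  case (step i)
  then show ?case
    using v1_recurrence[of i] htilde_1[of i N q e] by simp
qed

section \<open>The recursion for \<open>g\<close> rewritten in terms of
  \<open>htilde\<close>\<close>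

lemma g_1:
  assumes i: "1 \<le> i" "i < N"
  shows "g N q e i 1 = Fcoef q e i * htilde N q e (i + 1) 1"
  using i htilde_1_eq_v1[of "i + 1"] by (subst g.simps) simp

lemma g_1_eq_htilde_1:
  assumes i: "1 \<le> i" "i \<le> N"
  shows "g N q e i 1 = htilde N q e i 1 - Bcheck q i"
proof (cases "i = N")
  case True
  then show ?thesis
    using i htilde_1[of N N q e] by (simp add: g_at_N Bcheck_def)
next
  case False
  then show ?thesis
    using i htilde_1[of i N q e] g_1[of i] by (simp add: Bcheck_def)
qed

text \<open>For \<open>r \<ge> 3\<close> the summands \<open>k = 1\<close> and
  \<open>k = r - 1\<close> are distinct and can both be split off. In the remaining sum all
  superscripts are at least 2, the range in which the theorem relates \<open>g\<close> to
  \<open>htilde\<close>.\<close>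

lemma g_recurrence:
  assumes i: "1 \<le> i" "i < N" and r: "r \<ge> 3"
  shows "g N q e i r =
    Fcoef q e i * (g N q e (i + 1) r + htilde N q e (i + 1) 1 * g N q e (i + 1) (r - 1))
    + htilde N q e (i + 1) 1 * g N q e i (r - 1)
    + (\<Sum>k = 2..r - 2. g N q e (i + 1) k * g N q e i (r - k))"
proof -
  obtain m where m: "r = m + 3" using r by (metis le_add_diff_inverse2)
  let ?f = "\<lambda>k. g N q e (i + 1) k * g N q e i (r - k)"
  have "(\<Sum>k = 1..r - 1. ?f k) = ?f 1 + (\<Sum>k = 2..r - 2. ?f k) + ?f (r - 1)"
    by (simp add: m sum.atLeast_Suc_atMost numeral_2_eq_2)
  moreover have "g N q e i 1 = Fcoef q e i * htilde N q e (i + 1) 1"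
    using i by (intro g_1) auto
  moreover have "htilde N q e (i + 1) 1 = Bcheck q (i + 1) + g N q e (i + 1) 1"
    using i g_1_eq_htilde_1[of "i + 1"] by simp
  ultimately show ?thesis
    using i r by (subst g.simps) (simp add: algebra_simps)
qed

text \<open>Here the first and last summands coincide: the single product joins the linear term to
  give \<open>htilde N q e (i + 1) 1 * g N q e i 1\<close>, hence the square.\<close>

lemma g_2:
  assumes i: "1 \<le> i" "i < N"
  shows "g N q e i 2 = Fcoef q e i * (g N q e (i + 1) 2 + (htilde N q e (i + 1) 1)\<^sup>2)"
proof -
  have "g N q e i 1 = Fcoef q e i * htilde N q e (i + 1) 1"
    using i by (intro g_1) auto
  moreover have "htilde N q e (i + 1) 1 = Bcheck q (i + 1) + g N q e (i + 1) 1"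
    using i g_1_eq_htilde_1[of "i + 1"] by simp
  ultimately show ?thesis
    using i by (subst g.simps) (simp add: algebra_simps power2_eq_square)
qed

end

theorem theorem19:
  fixes N :: nat and q e :: "nat \<Rightarrow> real"
  assumes "N \<ge> 1"
    and "\<And>i. 1 \<le> i \<Longrightarrow> i \<le> N \<Longrightarrow> q i > 0"
    and "\<And>i. 1 \<le> i \<Longrightarrow> i \<le> N - 1 \<Longrightarrow> e i > 0"
  shows "\<forall>i M. 1 \<le> i \<and> i \<le> N \<and> 2 \<le> M \<longrightarrow>
           htilde N q e i M = fact M * g N q e i M"
proof -
  interpret positive_bidiagonal N q e
    using assms by unfold_locales
  have "htilde N q e i M = fact M * g N q e i M" if "i \<le> N" "1 \<le> i" "2 \<le> M" for i M
    using that
  proof (induction i arbitrary: M rule: inc_induct)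
    case base
    then show ?case
      by (subst htilde.simps) (simp add: g_at_N)
  next
    case (step i)
    note i = \<open>1 \<le> i\<close> \<open>i < N\<close>
    let ?h = "htilde N q e (i + 1) 1"
    have IH: "htilde N q e (i + 1) p = fact p * g N q e (i + 1) p" if "2 \<le> p" for p
      using step.IH[of p] that by simp
    from \<open>2 \<le> M\<close> show ?case
    \<comment> \<open>An inner strong induction is needed because the convolution refers to smaller
      superscripts at the same \<open>i\<close>.\<close>
    proof (induction M rule: less_induct)
      case (less p)
      have htilde_p: "htilde N q e i p =
          Fcoef q e i * (htilde N q e (i + 1) p + real p * ?h * htilde N q e (i + 1) (p - 1))
          + (\<Sum>k = 1..p - 2. real (p choose k) * htilde N q e (i + 1) k * htilde N q e i (p - k))"
        using i less.prems by (subst htilde.simps) simp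
      show ?case
      proof (cases "p = 2")
        case True
        \<comment> \<open>The sum is empty, and \<open>htilde N q e (i + 1) (p - 1)\<close> has
          superscript 1, outside the reach of \<open>IH\<close>.\<close>
        show ?thesis
          using htilde_p IH[of 2] g_2[OF i] True
          by (simp add: algebra_simps power2_eq_square)
      next
        case False
        then have p: "p \<ge> 3" using less.prems by simp
        have fact_p: "fact p = real p * fact (p - 1)"
          using p by (simp add: fact_reduce)
        let ?t = "\<lambda>k. real (p choose k) * htilde N q e (i + 1) k * htilde N q e i (p - k)"
        \<comment> \<open>The summand \<open>k = 1\<close> keeps its factor \<open>?h\<close>, as in
          \<open>g_recurrence\<close>; its binomial coefficient \<open>p\<close> completes
          \<open>fact (p - 1)\<close> to \<open>fact p\<close>.\<close>
        have "(\<Sum>k = 1..p - 2. ?t k) = ?t 1 + (\<Sum>k = 2..p - 2. ?t k)"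
          using p by (simp add: sum.atLeast_Suc_atMost numeral_2_eq_2)
        also have "?t 1 = fact p * (?h * g N q e i (p - 1))"
          using less.IH[of "p - 1"] p by (simp add: fact_p)
        also have "(\<Sum>k = 2..p - 2. ?t k) =
            (\<Sum>k = 2..p - 2. fact p * (g N q e (i + 1) k * g N q e i (p - k)))"
        proof (rule sum.cong)
          fix k assume "k \<in> {2..p - 2}"
          \<comment> \<open>These bounds make \<open>IH\<close> applicable to \<open>k\<close> and
            the inner hypothesis to \<open>p - k\<close>.\<close>
          then have k: "2 \<le> k" "k < p" "2 \<le> p - k" "k \<le> p" using p by auto
          then have "?t k = (fact k * fact (p - k) * real (p choose k)) *
              (g N q e (i + 1) k * g N q e i (p - k))"
            using IH[of k] less.IH[of "p - k"] by simp
          also have "fact k * fact (p - k) * real (p choose k) = fact p"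
            using binomial_fact_lemma[OF k(4)] by (metis of_nat_fact of_nat_mult)
          finally show "?t k = fact p * (g N q e (i + 1) k * g N q e i (p - k))" .
        qed simp
        finally have sum_eq: "(\<Sum>k = 1..p - 2. ?t k) = fact p * (?h * g N q e i (p - 1)
            + (\<Sum>k = 2..p - 2. g N q e (i + 1) k * g N q e i (p - k)))"
          by (simp add: sum_distrib_left distrib_left)
        have "real p * ?h * htilde N q e (i + 1) (p - 1) = fact p * (?h * g N q e (i + 1) (p - 1))"
          using IH[of "p - 1"] p by (simp add: fact_p)
        then show ?thesis
          unfolding htilde_p sum_eq
          using IH[of p] p g_recurrence[OF i p] by (simp add: distrib_left)
      qed
    qed
  qed
  then show ?thesis by blast
qed

end
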